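(* Let $h\colon[n]\to[n]$ be a Hessenberg function and let $w\in\mathfrak S_n$ be a generator for $h$. Then, as sets, $$[w,w_0]_h=[w,w_0],$$ where $[w,w_0]=\{u\in\mathfrak S_n\mid w\preceq u\preceq w_0\}$ is the interval in the Bruhat order and $[w,w_0]_h=\{u\in\mathfrak S_n\mid w\preceq_h u\preceq_h w_0\}$ is the interval in the $h$-Bruhat order.
   Context: A Hessenberg function is a nondecreasing function $h\colon[n]\to[n]$ with $h(i)\ge i$ for all $i$. Permutations $u\in\mathfrak S_n$ are written in one-line notation $u(1)u(2)\cdots u(n)$. For $1\le i<j\le n$, $u(i,j)$ denotes $u$ composed on the right with the transposition $(i,j)$, i.e. the permutation obtained from $u$ by swapping the entries in positions $i$ and $j$. The length $\ell(u)$ is the number of pairs $i<j$ with $u(i)>u(j)$. The Bruhat order $\preceq$ on $\mathfrak S_n$ is the reflexive–transitive closure of the relation $u\prec u(i,j)$ whenever $\ell(u)<\ell(u(i,j))$; $w_0=n(n-1)\cdots1$. The $h$-Bruhat order $\preceq_h$ is the reflexive–transitive closure of the relation $u\prec_h u(i,j)$ whenever $i<j\le h(i)$ and $\ell(u(i,j))>\ell(u)$. A permutation $w\in\mathfrak S_n$ is a generator for $h$ if $w^{-1}(w(i)+1)\le h(i)$ for every $i$ with $w(i)\le n-1$. *)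

theory Defs
  imports "HOL-Combinatorics.Permutations" "HOL-Library.FuncSet"
begin

text \<open>
  Elements of the symmetric group on \<open>[n]\<close> are functions \<open>u\<close> with \<open>u permutes {1..n}\<close>
  (the identity outside \<open>{1..n}\<close>).
\<close>

definition hessenberg :: "nat \<Rightarrow> (nat \<Rightarrow> nat) \<Rightarrow> bool" where
  "hessenberg n h \<longleftrightarrow>
     h \<in> {1..n} \<rightarrow> {1..n} \<and> mono_on {1..n} h \<and> (\<forall>i\<in>{1..n}. i \<le> h i)"

definition perm_length :: "nat \<Rightarrow> (nat \<Rightarrow> nat) \<Rightarrow> nat" where
  "perm_length n u = card {(i, j). i \<in> {1..n} \<and> j \<in> {1..n} \<and> i < j \<and> u j < u i}"

definition longest_perm :: "nat \<Rightarrow> nat \<Rightarrow> nat" where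
  "longest_perm n i = (if i \<in> {1..n} then n + 1 - i else i)"

text \<open>Right composition with \<open>transpose i j\<close> swaps the entries in positions \<open>i\<close> and \<open>j\<close>.\<close>

definition bruhat_step :: "nat \<Rightarrow> (nat \<Rightarrow> nat) \<Rightarrow> (nat \<Rightarrow> nat) \<Rightarrow> bool" where
  "bruhat_step n u v \<longleftrightarrow>
     u permutes {1..n} \<and>
     (\<exists>i\<in>{1..n}. \<exists>j\<in>{1..n}. i < j \<and> v = u \<circ> transpose i j \<and>
        perm_length n u < perm_length n v)"

definition bruhat_le :: "nat \<Rightarrow> (nat \<Rightarrow> nat) \<Rightarrow> (nat \<Rightarrow> nat) \<Rightarrow> bool" where
  "bruhat_le n = (bruhat_step n)\<^sup>*\<^sup>*"

definition h_bruhat_step ::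
  "nat \<Rightarrow> (nat \<Rightarrow> nat) \<Rightarrow> (nat \<Rightarrow> nat) \<Rightarrow> (nat \<Rightarrow> nat) \<Rightarrow> bool" where
  "h_bruhat_step n h u v \<longleftrightarrow>
     u permutes {1..n} \<and>
     (\<exists>i\<in>{1..n}. \<exists>j\<in>{1..n}. i < j \<and> j \<le> h i \<and> v = u \<circ> transpose i j \<and>
        perm_length n u < perm_length n v)"

definition h_bruhat_le ::
  "nat \<Rightarrow> (nat \<Rightarrow> nat) \<Rightarrow> (nat \<Rightarrow> nat) \<Rightarrow> (nat \<Rightarrow> nat) \<Rightarrow> bool" where
  "h_bruhat_le n h = (h_bruhat_step n h)\<^sup>*\<^sup>*"

text \<open>
  \<open>rtranclp\<close> is also reflexive at functions that are not permutations of \<open>{1..n}\<close>,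
  so membership in the symmetric group is required explicitly here.
\<close>

definition bruhat_interval ::
  "nat \<Rightarrow> (nat \<Rightarrow> nat) \<Rightarrow> (nat \<Rightarrow> nat) \<Rightarrow> (nat \<Rightarrow> nat) set" where
  "bruhat_interval n v w = {u. u permutes {1..n} \<and> bruhat_le n v u \<and> bruhat_le n u w}"

definition h_bruhat_interval ::
  "nat \<Rightarrow> (nat \<Rightarrow> nat) \<Rightarrow> (nat \<Rightarrow> nat) \<Rightarrow> (nat \<Rightarrow> nat) \<Rightarrow> (nat \<Rightarrow> nat) set" where
  "h_bruhat_interval n h v w =
     {u. u permutes {1..n} \<and> h_bruhat_le n h v u \<and> h_bruhat_le n h u w}"

definition hessenberg_generator :: "nat \<Rightarrow> (nat \<Rightarrow> nat) \<Rightarrow> (nat \<Rightarrow> nat) \<Rightarrow> bool" where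
  "hessenberg_generator n h w \<longleftrightarrow>
     w permutes {1..n} \<and> (\<forall>i\<in>{1..n}. w i \<le> n - 1 \<longrightarrow> inv w (w i + 1) \<le> h i)"

end

theory Submission
  imports Defs
begin

text \<open>
  The Bruhat order is handled through the counts of large entries in prefixes. Let \<open>w \<preceq> u\<close> agree
  before position \<open>k\<close> and put \<open>b = u k\<close>. Going right from position \<open>k\<close>, let
  \<open>k = p\<^sub>0 < p\<^sub>1 < \<dots> < p\<^sub>r\<close> be the positions where \<open>w\<close> attains a new maximum among its entries
  that are at most \<open>b\<close>, so that \<open>w p\<^sub>r = b\<close>. Bubbling \<open>b\<close> down to position \<open>k\<close> by exchanging
  positions \<open>(p\<^sub>r\<^sub>-\<^sub>1, p\<^sub>r)\<close>, then \<open>(p\<^sub>r\<^sub>-\<^sub>2, p\<^sub>r\<^sub>-\<^sub>1)\<close>, and so on, yields the least permutation above \<open>w\<close>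
  with the prefix of \<open>u\<close> up to \<open>k\<close>; the generator condition makes every exchange an \<open>h\<close>-step.
  The generator condition, read only on the entries from position \<open>k\<close> on, survives as the
  condition on the entries from position \<open>k + 1\<close> on, so one can repeat the process with \<open>k + 1\<close>.
\<close>

section \<open>Prefix counts under exchanges of positions\<close>

text \<open>The rank function of the tableau criterion for the Bruhat order. In general only its
  monotonicity is shown; the converse is shown above a generator, where it yields a chain of
  \<open>h\<close>-steps.\<close>

definition prefix_count :: "(nat \<Rightarrow> nat) \<Rightarrow> nat \<Rightarrow> nat \<Rightarrow> nat" where
  "prefix_count u p v = card {m \<in> {1..p}. v \<le> u m}"

lemma prefix_count_cong:
  assumes "\<And>m. m \<in> {1..p} \<Longrightarrow> u m = w m"
  shows "prefix_count u p v = prefix_count w p v"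
proof -
  have "{m \<in> {1..p}. v \<le> u m} = {m \<in> {1..p}. v \<le> w m}"
    using assms by auto
  then show ?thesis by (simp add: prefix_count_def)
qed

lemma prefix_count_eq_sum:
  "prefix_count u p v = (\<Sum>m\<in>{1..p}. if v \<le> u m then 1 else 0)"
  by (simp add: prefix_count_def sum.If_cases Int_def)

lemma prefix_count_split:
  assumes "v \<le> b"
  shows "prefix_count u p v = card {m \<in> {1..p}. v \<le> u m \<and> u m \<le> b} + prefix_count u p (b + 1)"
proof -
  have "{m \<in> {1..p}. v \<le> u m} = {m \<in> {1..p}. v \<le> u m \<and> u m \<le> b} \<union> {m \<in> {1..p}. b + 1 \<le> u m}"
    using assms by auto
  then show ?thesis
    unfolding prefix_count_def by (subst card_Un_disjoint[symmetric]) (auto)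
qed

text \<open>A prefix ending before \<open>i\<close> is untouched, one reaching \<open>j\<close> is
  only rearranged, and one ending in between trades \<open>u i\<close> for the larger
  \<open>u j\<close>.\<close>

lemma prefix_count_transpose:
  assumes "1 \<le> i" "i < j" "u i < u j"
  shows "prefix_count (u \<circ> transpose i j) p v =
    prefix_count u p v + (if i \<le> p \<and> p < j \<and> u i < v \<and> v \<le> u j then 1 else 0)"
proof -
  let ?v = "u \<circ> transpose i j"
  consider "p < i" | "i \<le> p" "p < j" | "j \<le> p" by linarith
  then show ?thesis
  proof cases
    case 1
    then have "prefix_count ?v p v = prefix_count u p v"
      using assms by (intro prefix_count_cong) (auto simp: transpose_def)
    then show ?thesis using 1 by simp
  next
    case 2
    have rest: "(\<Sum>m\<in>{1..p} - {i}. if v \<le> ?v m then 1 else 0 :: nat)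
        = (\<Sum>m\<in>{1..p} - {i}. if v \<le> u m then 1 else 0)"
      using 2 by (intro sum.cong) (auto simp: transpose_def)
    have "i \<in> {1..p}" using assms 2 by simp
    then have remove: "sum f {1..p} = f i + sum f ({1..p} - {i})" for f :: "nat \<Rightarrow> nat"
      by (intro sum.remove) auto
    show ?thesis
      unfolding prefix_count_eq_sum remove rest using 2 assms by auto
  next
    case 3
    have "bij_betw (transpose i j) {1..p} {1..p}"
      using 3 assms by (intro permutes_imp_bij permutes_swap_id) auto
    then have "prefix_count ?v p v = prefix_count u p v"
      unfolding prefix_count_eq_sum
      by (simp add: sum.reindex_bij_betw[of _ _ _ "\<lambda>m. if v \<le> u m then 1 else 0"])
    then show ?thesis using 3 by simp
  qed
qed

section \<open>Length, ascents and the two orders\<close>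

lemma transpose_permutes:
  assumes "u permutes {1..n}" "i \<in> {1..n}" "j \<in> {1..n}"
  shows "u \<circ> transpose i j permutes {1..n}"
  using assms by (intro permutes_compose permutes_swap_id)

lemma permutes_in_range:
  assumes "u permutes {1..n}" "i \<in> {1..n}"
  shows "u i \<in> {1..n}"
  using assms by (simp only: permutes_in_image)

lemma perm_length_transpose_less:
  assumes "i \<in> {1..n}" "j \<in> {1..n}" "i < j" "u i < u j"
  shows "perm_length n u < perm_length n (u \<circ> transpose i j)"
proof -
  let ?t = "transpose i j"
  define I where
    "I = (\<lambda>u :: nat \<Rightarrow> nat. {(x, y). x \<in> {1..n} \<and> y \<in> {1..n} \<and> x < y \<and> u y < u x})"
  \<comment> \<open>An inversion is carried along by the exchange unless this would reverse the
    pair; then it stays put. The exchange keeps the order of images of the first kind only, so the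
    two kinds never collide.\<close>
  define \<phi> where "\<phi> = (\<lambda>(x, y). if ?t x < ?t y then (?t x, ?t y) else (x, y))"
  have fin: "finite (I w)" for w
    by (rule finite_subset[of _ "{1..n} \<times> {1..n}"]) (auto simp: I_def)
  have "inj_on \<phi> (I u)"
  proof (rule inj_onI, clarify)
    fix x y x' y'
    assume "(x, y) \<in> I u" "(x', y') \<in> I u" "\<phi> (x, y) = \<phi> (x', y')"
    then show "x = x' \<and> y = y'"
      by (auto simp: \<phi>_def I_def transpose_eq_iff split: if_splits)
  qed
  moreover have "\<phi> ` I u \<subseteq> I (u \<circ> ?t) - {(i, j)}"
    using assms by (fastforce simp: \<phi>_def I_def transpose_def split: if_splits)
  ultimately have "card (I u) \<le> card (I (u \<circ> ?t) - {(i, j)})"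
    using fin by (metis card_image card_mono finite_Diff)
  also have "(i, j) \<in> I (u \<circ> ?t)"
    using assms by (simp add: I_def)
  then have "card (I (u \<circ> ?t) - {(i, j)}) < card (I (u \<circ> ?t))"
    using fin by (metis card_Diff1_less)
  finally show ?thesis by (simp add: I_def perm_length_def)
qed

lemma perm_length_transpose_less_iff:
  assumes "u permutes {1..n}" "i \<in> {1..n}" "j \<in> {1..n}" "i < j"
  shows "perm_length n u < perm_length n (u \<circ> transpose i j) \<longleftrightarrow> u i < u j"
proof
  assume less: "perm_length n u < perm_length n (u \<circ> transpose i j)"
  show "u i < u j"
  proof (rule ccontr)
    assume "\<not> u i < u j"
    moreover have "u i \<noteq> u j"
      using assms(1,4) by (metis less_irrefl permutes_inj injD)
    ultimately have "perm_length n (u \<circ> transpose i j) <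
        perm_length n (u \<circ> transpose i j \<circ> transpose i j)"
      using assms by (intro perm_length_transpose_less) auto
    then show False using less by (simp add: comp_assoc)
  qed
qed (use assms perm_length_transpose_less in blast)

lemma bruhat_step_prefix_count_mono:
  assumes "bruhat_step n u v"
  shows "prefix_count u p x \<le> prefix_count v p x"
  using assms unfolding bruhat_step_def
  by (auto simp: perm_length_transpose_less_iff prefix_count_transpose)

lemma bruhat_le_prefix_count_mono:
  assumes "bruhat_le n u v"
  shows "prefix_count u p x \<le> prefix_count v p x"
  using assms unfolding bruhat_le_def
  by (induction rule: rtranclp_induct) (auto dest: bruhat_step_prefix_count_mono order_trans)

lemma h_bruhat_step_imp_bruhat_step: "h_bruhat_step n h u v \<Longrightarrow> bruhat_step n u v"
  unfolding h_bruhat_step_def bruhat_step_def by blast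

lemma h_bruhat_le_imp_bruhat_le: "h_bruhat_le n h u v \<Longrightarrow> bruhat_le n u v"
  unfolding h_bruhat_le_def bruhat_le_def
  by (erule rtranclp_mono[THEN predicate2D, rotated]) (auto dest: h_bruhat_step_imp_bruhat_step)

lemma h_bruhat_step_transpose:
  assumes "u permutes {1..n}" "i \<in> {1..n}" "j \<in> {1..n}" "i < j" "j \<le> h i" "u i < u j"
  shows "h_bruhat_step n h u (u \<circ> transpose i j)"
  unfolding h_bruhat_step_def using assms perm_length_transpose_less by blast

section \<open>Records and the bubbling of one value\<close>

text \<open>
  Left-to-right maxima, from position \<open>s\<close> on, of the word formed by the entries at most \<open>b\<close>.
\<close>

definition record_pos :: "(nat \<Rightarrow> nat) \<Rightarrow> nat \<Rightarrow> nat \<Rightarrow> nat \<Rightarrow> bool" where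
  "record_pos w b s p \<longleftrightarrow> s \<le> p \<and> w p \<le> b \<and> (\<forall>m. s \<le> m \<and> m < p \<and> w m \<le> b \<longrightarrow> w m < w p)"

text \<open>No start \<open>s\<close> occurs here, so the relation stays the same while the
  induction moves \<open>s\<close> to the right.\<close>

definition next_record :: "(nat \<Rightarrow> nat) \<Rightarrow> nat \<Rightarrow> nat \<Rightarrow> nat \<Rightarrow> bool" where
  "next_record w b p q \<longleftrightarrow>
     p < q \<and> w p < w q \<and> w q \<le> b \<and> (\<forall>m. p < m \<and> m < q \<longrightarrow> \<not> (w p < w m \<and> w m \<le> b))"

text \<open>Strictly between \<open>s\<close> and \<open>j\<close> every entry is at most
  \<open>w s\<close> or above \<open>b\<close>, so no record lies there.\<close>

lemma record_pos_next_record_iff: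
  assumes "w s \<le> b" "next_record w b s j"
  shows "record_pos w b s m \<longleftrightarrow> m = s \<or> record_pos w b j m"
proof
  assume rec: "record_pos w b s m"
  have "j \<le> m" if "m \<noteq> s"
  proof -
    have "s < m" "w m \<le> b" using rec that by (simp_all add: record_pos_def)
    moreover from this have "w s < w m" using rec assms(1) by (simp add: record_pos_def)
    ultimately show ?thesis
      using assms(2) unfolding next_record_def by (meson not_le)
  qed
  then show "m = s \<or> record_pos w b j m"
    using rec assms(2) unfolding record_pos_def next_record_def by auto
next
  assume R: "m = s \<or> record_pos w b j m"
  show "record_pos w b s m"
  proof (cases "m = s")
    case True
    then show ?thesis using assms(1) by (simp add: record_pos_def)
  next
    case False
    with R have rec: "record_pos w b j m" by simp
    have jm: "w j \<le> w m" "j \<le> m"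
      using rec assms(2) by (cases "j = m"; simp add: record_pos_def next_record_def less_imp_le)+
    have "w x < w m" if "s \<le> x" "x < m" "w x \<le> b" for x
    proof (cases "j \<le> x")
      case True
      then show ?thesis using rec that by (simp add: record_pos_def)
    next
      case False
      then have "w x \<le> w s"
        using assms(2) that unfolding next_record_def
        by (cases "s < x") (auto simp: not_le not_less)
      then show ?thesis using jm assms(2) by (simp add: next_record_def)
    qed
    then show ?thesis
      using rec assms(2) by (auto simp: record_pos_def next_record_def)
  qed
qed

lemma next_record_exists:
  assumes "s < q" "w s < w q" "w q \<le> b"
  obtains j where "next_record w b s j" "j \<le> q"
proof -
  let ?P = "\<lambda>j. s < j \<and> w s < w j \<and> w j \<le> b"
  have "?P q" using assms by simp
  then have "?P (LEAST j. ?P j)" "(LEAST j. ?P j) \<le> q"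
    by (rule LeastI[of ?P], rule Least_le[of ?P])
  moreover have "\<not> ?P m" if "m < (LEAST j. ?P j)" for m
    using that by (rule not_less_Least[of _ ?P])
  ultimately show ?thesis
    using that[of "LEAST j. ?P j"] unfolding next_record_def by blast
qed

text \<open>Induction on \<open>q - s\<close>: \<open>b\<close> first travels to the next record
  \<open>j\<close>, then \<open>s\<close> and \<open>j\<close> are exchanged. The last clause
  expresses minimality: the count grows by at most one, and only where \<open>w\<close> misses the
  window from \<open>v\<close> to \<open>b\<close> on \<open>{s..p}\<close>.\<close>

lemma bubble_value:
  assumes "w permutes {1..n}" "s \<in> {1..n}" "s \<le> q" "q \<le> n" "w q = b" "w s \<le> b"
    and "\<forall>p p'. record_pos w b s p \<longrightarrow> next_record w b p p' \<longrightarrow> p' \<le> h p"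
  shows "\<exists>w'. w' permutes {1..n} \<and> h_bruhat_le n h w w' \<and> w' s = b \<and> (\<forall>m<s. w' m = w m) \<and>
    (\<forall>m>s. \<not> record_pos w b s m \<longrightarrow> w' m = w m) \<and>
    (\<forall>m>s. record_pos w b s m \<longrightarrow> (\<exists>p. record_pos w b s p \<and> next_record w b p m \<and> w' m = w p)) \<and>
    (\<forall>p v. prefix_count w' p v \<le> prefix_count w p v +
       (if s \<le> p \<and> v \<le> b \<and> (\<forall>m\<in>{s..p}. \<not> (v \<le> w m \<and> w m \<le> b)) then 1 else 0))"
  using assms
proof (induction "q - s" arbitrary: s rule: less_induct)
  case less
  show ?case
  proof (cases "w s = b")
    case True
    have "\<not> record_pos w b s m" if "m > s" for m
      using that True by (auto simp: record_pos_def)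
    then show ?thesis
      using less.prems True by (intro exI[of _ w]) (auto simp: h_bruhat_le_def)
  next
    case False
    then have lt: "w s < b" "s < q"
      using less.prems by (auto simp: le_less)
    obtain j where j: "next_record w b s j" "j \<le> q"
      using next_record_exists[of s q w b] lt less.prems by auto
    have sj: "s < j" "w s < w j" "w j \<le> b"
      using j by (auto simp: next_record_def)
    note rec_iff = record_pos_next_record_iff[OF less.prems(6) j(1)]
    have "\<exists>w'. w' permutes {1..n} \<and> h_bruhat_le n h w w' \<and> w' j = b \<and> (\<forall>m<j. w' m = w m) \<and>
      (\<forall>m>j. \<not> record_pos w b j m \<longrightarrow> w' m = w m) \<and>
      (\<forall>m>j. record_pos w b j m \<longrightarrow> (\<exists>p. record_pos w b j p \<and> next_record w b p m \<and> w' m = w p)) \<and>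
      (\<forall>p v. prefix_count w' p v \<le> prefix_count w p v +
         (if j \<le> p \<and> v \<le> b \<and> (\<forall>m\<in>{j..p}. \<not> (v \<le> w m \<and> w m \<le> b)) then 1 else 0))"
    proof (rule less.hyps)
      show "\<forall>p p'. record_pos w b j p \<longrightarrow> next_record w b p p' \<longrightarrow> p' \<le> h p"
        using less.prems(7) rec_iff by blast
    qed (use less.prems j sj in auto)
    then obtain x where x: "x permutes {1..n}" "h_bruhat_le n h w x" "x j = b"
      and x_lt: "\<And>m. m < j \<Longrightarrow> x m = w m"
      and x_nrec: "\<And>m. m > j \<Longrightarrow> \<not> record_pos w b j m \<Longrightarrow> x m = w m"
      and x_rec: "\<And>m. m > j \<Longrightarrow> record_pos w b j m \<Longrightarrow>
        \<exists>p. record_pos w b j p \<and> next_record w b p m \<and> x m = w p"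
      and x_count: "\<And>p v. prefix_count x p v \<le> prefix_count w p v +
         (if j \<le> p \<and> v \<le> b \<and> (\<forall>m\<in>{j..p}. \<not> (v \<le> w m \<and> w m \<le> b)) then 1 else 0)"
      by blast
    have xs: "x s = w s" using x_lt sj by simp
    have in_range: "j \<in> {1..n}" using sj j less.prems by simp
    have rec_s: "record_pos w b s s" using rec_iff by simp
    \<comment> \<open>Position \<open>s\<close> still holds \<open>w s\<close> and \<open>j\<close>
      now holds \<open>b\<close>, so this exchange is an ascent.\<close>
    let ?y = "x \<circ> transpose s j"
    have "h_bruhat_step n h x ?y"
      using x xs lt sj in_range less.prems(2) less.prems(7)[rule_format, OF rec_s j(1)]
      by (intro h_bruhat_step_transpose) auto
    then have "h_bruhat_le n h w ?y"
      using x(2) unfolding h_bruhat_le_def by simp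
    moreover have "?y permutes {1..n}"
      using x(1) less.prems(2) in_range by (rule transpose_permutes)
    moreover have "?y s = b" using x(3) by simp
    moreover have "?y m = w m" if "m < s" for m
      using that sj x_lt by simp
    moreover have "?y m = w m" if "m > s" "\<not> record_pos w b s m" for m
    proof -
      have "record_pos w b j j" using sj by (simp add: record_pos_def)
      then have "\<not> record_pos w b j m" "m \<noteq> j"
        using that rec_iff by blast+
      then show ?thesis
        using that x_lt[of m] x_nrec[of m] by (cases "m < j") auto
    qed
    moreover have "\<exists>p. record_pos w b s p \<and> next_record w b p m \<and> ?y m = w p"
      if "m > s" "record_pos w b s m" for m
    proof (cases "m = j")
      case True
      then show ?thesis using rec_s j(1) xs by (intro exI[of _ s]) simp
    next
      case False
      have "record_pos w b j m" using that rec_iff by simp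
      then have "m > j" using False by (simp add: record_pos_def)
      then obtain p where "record_pos w b j p" "next_record w b p m" "x m = w p"
        using x_rec \<open>record_pos w b j m\<close> by blast
      then show ?thesis using rec_iff that False by (intro exI[of _ p]) simp
    qed
    moreover have "prefix_count ?y p v \<le> prefix_count w p v +
       (if s \<le> p \<and> v \<le> b \<and> (\<forall>m\<in>{s..p}. \<not> (v \<le> w m \<and> w m \<le> b)) then 1 else 0)" for p v
    proof -
      have count: "prefix_count ?y p v =
          prefix_count x p v + (if s \<le> p \<and> p < j \<and> w s < v \<and> v \<le> b then 1 else 0)"
        using prefix_count_transpose[of s j x p v] less.prems(2) sj x(3) xs lt by auto
      \<comment> \<open>Before the next record, an entry above \<open>w s\<close> is also above
        \<open>b\<close>.\<close>
      have gap: "\<not> (v \<le> w m \<and> w m \<le> b)" if "w s < v" "s \<le> m" "m < j" for m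
        using that j(1) unfolding next_record_def
        by (metis le_neq_implies_less leD less_le_trans)
      show ?thesis
      proof (cases "p < j")
        case True
        then have "prefix_count x p v = prefix_count w p v"
          using x_lt by (intro prefix_count_cong) auto
        then show ?thesis using count True gap by auto
      next
        case False
        \<comment> \<open>Emptiness at \<open>j\<close> forces \<open>v > w j > w s\<close>, so
          \<open>gap\<close> extends the empty range back to \<open>s\<close>.\<close>
        have "\<forall>m\<in>{s..p}. \<not> (v \<le> w m \<and> w m \<le> b)"
          if H: "\<forall>m\<in>{j..p}. \<not> (v \<le> w m \<and> w m \<le> b)"
        proof
          fix m assume "m \<in> {s..p}"
          have "\<not> v \<le> w j" using H sj(3) False by (meson atLeastAtMost_iff le_refl not_less)
          then have "w s < v" using sj by simp
          then show "\<not> (v \<le> w m \<and> w m \<le> b)"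
            using H gap[of m] \<open>m \<in> {s..p}\<close> by (cases "m < j") auto
        qed
        then show ?thesis using count x_count[of p v] False sj by (auto split: if_splits)
      qed
    qed
    ultimately show ?thesis by blast
  qed
qed

section \<open>The generator condition on a suffix\<close>

text \<open>
  The generator condition for the word \<open>w k, \<dots>, w n\<close> standardised to a permutation; for \<open>k = 1\<close>
  this is the condition on \<open>w\<close> itself.
\<close>

definition suffix_generator :: "nat \<Rightarrow> (nat \<Rightarrow> nat) \<Rightarrow> nat \<Rightarrow> (nat \<Rightarrow> nat) \<Rightarrow> bool" where
  "suffix_generator n h k w \<longleftrightarrow>
     (\<forall>i\<in>{k..n}. \<forall>l\<in>{k..n}. w i < w l \<and> (\<forall>m\<in>{k..n}. \<not> (w i < w m \<and> w m < w l)) \<longrightarrow> l \<le> h i)"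

lemma hessenberg_generator_imp_suffix_generator:
  assumes "hessenberg_generator n h w"
  shows "suffix_generator n h 1 w"
  unfolding suffix_generator_def
proof (intro ballI impI)
  fix i l
  assume il: "i \<in> {1..n}" "l \<in> {1..n}"
    and A: "w i < w l \<and> (\<forall>m\<in>{1..n}. \<not> (w i < w m \<and> w m < w l))"
  have w: "w permutes {1..n}" using assms by (simp add: hessenberg_generator_def)
  have "w l \<in> {1..n}" using w il(2) by (rule permutes_in_range)
  then have "w i + 1 \<in> {1..n}" using A by auto
  then obtain m where m: "m \<in> {1..n}" "w m = w i + 1"
    using w by (metis permutes_image imageE)
  then have "w l = w i + 1" using A bspec[of "{1..n}" _ m] by fastforce
  then have "inv w (w i + 1) = l" using w by (metis permutes_inverses(2))
  moreover have "w i \<le> n - 1" using \<open>w i + 1 \<in> {1..n}\<close> by auto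
  ultimately show "l \<le> h i" using assms il by (auto simp: hessenberg_generator_def)
qed

text \<open>The generator condition bounds the position \<open>l\<close> of the next larger value
  after \<open>w p\<close> in the suffix. As \<open>p\<close> is a record and \<open>w l\<close> is
  at most \<open>b\<close>, \<open>l\<close> lies after \<open>p\<close>, so the next record
  \<open>p'\<close> comes no later than \<open>l\<close>.\<close>

lemma suffix_generator_next_record:
  assumes gen: "suffix_generator n h k w" and w: "w permutes {1..n}"
    and b: "b \<in> w ` {k..n}" and k: "1 \<le> k"
    and rec: "record_pos w b k p" and nxt: "next_record w b p p'"
  shows "p' \<le> h p"
proof -
  have pp: "p < p'" "w p < w p'" "w p' \<le> b" "k \<le> p"
    using rec nxt by (auto simp: record_pos_def next_record_def)
  have "b \<le> n" using b k permutes_in_range[OF w] by fastforce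
  \<comment> \<open>Beyond \<open>n\<close> the permutation is the identity, so its values there
    exceed \<open>b\<close>.\<close>
  then have "p' \<le> n"
    using w pp by (metis atLeastAtMost_iff leI le_trans permutes_not_in)
  define S where "S = {x \<in> w ` {k..n}. w p < x}"
  have "w p' \<in> S" "finite S" using pp \<open>p' \<le> n\<close> by (auto simp: S_def)
  then have min: "Min S \<in> S" "\<And>x. x \<in> S \<Longrightarrow> Min S \<le> x"
    using Min_in[of S] Min_le[of S] by blast+
  then obtain l where l: "l \<in> {k..n}" "w l = Min S" "w p < w l"
    by (auto simp: S_def)
  have "w l \<le> b" using min(2) \<open>w p' \<in> S\<close> l pp by fastforce
  have "l \<le> h p"
  proof -
    have "\<not> (w p < w m \<and> w m < w l)" if "m \<in> {k..n}" for m
    proof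
      assume "w p < w m \<and> w m < w l"
      moreover from this have "w m \<in> S" using that by (simp add: S_def)
      ultimately show False using min(2)[of "w m"] l(2) by simp
    qed
    moreover have "p \<in> {k..n}" using pp \<open>p' \<le> n\<close> by simp
    ultimately show ?thesis
      using gen l(1,3) unfolding suffix_generator_def by blast
  qed
  moreover have "p < l"
    using rec l \<open>w l \<le> b\<close> unfolding record_pos_def
    by (metis atLeastAtMost_iff less_asym nat_neq_iff)
  then have "p' \<le> l"
    using nxt l \<open>w l \<le> b\<close> unfolding next_record_def by (meson not_le)
  ultimately show ?thesis by simp
qed

text \<open>Record values move right, where \<open>h\<close> is no smaller. If \<open>l\<close> is a
  record, it is bounded through the preceding record. Any other \<open>l\<close> keeps its entry, so
  the old condition applies, from \<open>i0\<close> or, if \<open>b\<close> separated the two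
  values, from \<open>q\<close>.\<close>

lemma suffix_generator_bubble:
  assumes gen: "suffix_generator n h k w" and w: "w permutes {1..n}" and w': "w' permutes {1..n}"
    and hess: "hessenberg n h"
    and k: "1 \<le> k" and q: "q \<in> {k..n}" "w q = b"
    and w'k: "w' k = b"
    and pre: "\<And>m. m < k \<Longrightarrow> w' m = w m"
    and nrec: "\<And>m. m > k \<Longrightarrow> \<not> record_pos w b k m \<Longrightarrow> w' m = w m"
    and rec: "\<And>m. m > k \<Longrightarrow> record_pos w b k m \<Longrightarrow>
      \<exists>p. record_pos w b k p \<and> next_record w b p m \<and> w' m = w p"
  shows "suffix_generator n h (Suc k) w'"
  unfolding suffix_generator_def
proof (intro ballI impI)
  fix i l
  assume il: "i \<in> {Suc k..n}" "l \<in> {Suc k..n}"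
    and A: "w' i < w' l \<and> (\<forall>m\<in>{Suc k..n}. \<not> (w' i < w' m \<and> w' m < w' l))"
  have inj: "w x = w y \<longleftrightarrow> x = y" "w' x = w' y \<longleftrightarrow> x = y" for x y
    using permutes_inj[OF w] permutes_inj[OF w'] by (simp_all add: inj_eq)
  have hmono: "h x \<le> h y" if "k \<le> x" "x \<le> y" "y \<le> n" for x y
    using hess k that unfolding hessenberg_def by (auto elim!: mono_onD)
  have next_le: "p' \<le> h p" if "record_pos w b k p" "next_record w b p p'" for p p'
    using suffix_generator_next_record[OF gen w _ k that] q by blast
  text \<open>The values on positions \<open>k + 1, \<dots>, n\<close> are those of \<open>w\<close> on \<open>k, \<dots>, n\<close> without \<open>b\<close>.\<close>
  have between: "\<not> (w' i < w m \<and> w m < w' l)" if m: "m \<in> {k..n}" "m \<noteq> q" for m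
  proof -
    have "w m \<in> w' ` {1..n}"
      using w w' m k by (metis atLeastAtMost_iff le_trans permutes_image permutes_in_image)
    then obtain m' where m': "m' \<in> {1..n}" "w' m' = w m" by auto
    have "\<not> m' < k" using pre[of m'] m' m inj by auto
    moreover have "m' \<noteq> k" using m' m q w'k inj by metis
    ultimately have "m' \<in> {Suc k..n}" using m' by auto
    then show ?thesis using A m' by metis
  qed
  have "i > k" "l > k" "l \<in> {k..n}" using il by simp_all
  obtain i0 where i0: "i0 \<in> {k..i}" "w' i = w i0" "i0 \<in> {k..n}"
    and i0_rec: "record_pos w b k i \<Longrightarrow> record_pos w b k i0 \<and> next_record w b i0 i"
    and i0_nrec: "\<not> record_pos w b k i \<Longrightarrow> i0 = i"
  proof (cases "record_pos w b k i")
    case True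
    then obtain p where p: "record_pos w b k p" "next_record w b p i" "w' i = w p"
      using rec[OF \<open>i > k\<close>] by blast
    then have "p \<in> {k..i}" "p \<in> {k..n}"
      using il by (simp_all add: record_pos_def next_record_def)
    with p True show ?thesis using that by blast
  next
    case False
    have "i \<in> {k..i}" "i \<in> {k..n}" using il by simp_all
    then show ?thesis using that nrec[OF \<open>i > k\<close>] False by blast
  qed
  show "l \<le> h i"
  proof (cases "record_pos w b k l")
    case False
    then have l: "w' l = w l" using nrec[OF \<open>l > k\<close>] by simp
    show ?thesis
    proof (cases "w i0 < b \<and> b < w l")
      case False
      then have "\<forall>m\<in>{k..n}. \<not> (w i0 < w m \<and> w m < w l)"
        using between i0 l q by metis
      then have "l \<le> h i0"
        using gen i0 A l \<open>l \<in> {k..n}\<close> unfolding suffix_generator_def by metis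
      also have "\<dots> \<le> h i" using hmono i0 il by auto
      finally show ?thesis .
    next
      case True
      have above: "\<forall>m\<in>{k..n}. \<not> (w q < w m \<and> w m < w l)"
      proof
        fix m assume "m \<in> {k..n}"
        then show "\<not> (w q < w m \<and> w m < w l)"
          using between[of m] i0(2) l True q(2) by (cases "m = q") auto
      qed
      have "l \<le> h q"
        using gen q above True \<open>l \<in> {k..n}\<close> unfolding suffix_generator_def by blast
      \<comment> \<open>An old suffix entry strictly between \<open>w i0\<close> and
        \<open>w l\<close> can only be \<open>b\<close>. A record \<open>i\<close> carries such an
        entry itself; otherwise one lies before \<open>i\<close>.\<close>
      moreover have "q \<le> i"
      proof (cases "record_pos w b k i")
        case True': True
        have "w i \<le> b" "w i0 < w i"
          using i0_rec[OF True'] by (auto simp: next_record_def)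
        then have "i = q"
          using between[of i] i0 l True il by (metis Suc_leD atLeastAtMost_iff le_less_trans)
        then show ?thesis by simp
      next
        case False
        then have "i0 = i" by (rule i0_nrec)
        then obtain m where m: "k \<le> m" "m < i" "w m \<le> b" "w i \<le> w m"
          using False True il unfolding record_pos_def by (auto simp: not_less)
        then have "w i < w m" using inj by (metis le_neq_implies_less nat_neq_iff)
        then have "m = q"
          using between[of m] i0 l True il m \<open>i0 = i\<close> by auto
        then show ?thesis using m by simp
      qed
      ultimately show ?thesis using hmono[of q i] q il by auto
    qed
  next
    case True
    then obtain p where p: "record_pos w b k p" "next_record w b p l" "w' l = w p"
      using rec[OF \<open>l > k\<close>] by blast
    have pb: "w p < b" "k \<le> p" "p \<le> n" "p < l"
      using p il by (auto simp: record_pos_def next_record_def)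
    have btw: "\<not> (w i0 < w m \<and> w m < w p)" if "m \<in> {k..n}" for m
      using between[of m] that i0 p q pb by (metis less_asym)
    have "w i0 < w p" using A i0 p by simp
    \<comment> \<open>No suffix value lies strictly between \<open>w i0\<close> and
      \<open>w p\<close>. Hence an entry of at least \<open>w p\<close> and at most \<open>b\<close>
      stands at \<open>i\<close>, if \<open>i\<close> is a record, or else before \<open>i\<close>;
      the record \<open>p\<close> cannot come after it.\<close>
    have "p \<le> i"
    proof (cases "record_pos w b k i")
      case True': True
      have n: "next_record w b i0 i" "record_pos w b k i0" using i0_rec[OF True'] by auto
      then have "w i0 < w i" by (simp add: next_record_def)
      then have "w p \<le> w i" using btw[of i] il by auto
      then show ?thesis
        using p(1) True' inj unfolding record_pos_def by (metis leD leI)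
    next
      case False
      then have "i0 = i" by (rule i0_nrec)
      then have "w i \<le> b" using \<open>w i0 < w p\<close> pb by simp
      then obtain m where m: "k \<le> m" "m < i" "w m \<le> b" "w i \<le> w m"
        using False il unfolding record_pos_def by (auto simp: not_less)
      then have "w i < w m" using inj by (metis le_neq_implies_less nat_neq_iff)
      then have "w p \<le> w m" using btw[of m] m il \<open>i0 = i\<close> by auto
      then have "\<not> m < p" using p(1) m unfolding record_pos_def by auto
      then show ?thesis using m by simp
    qed
    then have "h p \<le> h i" using hmono pb il by auto
    with next_le[OF p(1,2)] show ?thesis by simp
  qed
qed

section \<open>The chain from \<open>w\<close> up to \<open>u\<close>\<close>

text \<open>Domination of counts replaces the Bruhat order as the invariant, since it can be checked
  for the bubbled permutation.\<close>

lemma suffix_generator_h_bruhat_le: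
  assumes "hessenberg n h" "w permutes {1..n}" "u permutes {1..n}" "1 \<le> k"
    and "\<And>m. m < k \<Longrightarrow> w m = u m"
    and "\<And>p v. prefix_count w p v \<le> prefix_count u p v"
    and "suffix_generator n h k w"
  shows "h_bruhat_le n h w u"
  using assms
proof (induction "Suc n - k" arbitrary: k w)
  case 0
  have "w m = u m" for m
  proof (cases "m < k")
    case False
    then have "m \<notin> {1..n}" using 0(1) by simp
    then show ?thesis using 0(3,4) by (metis permutes_not_in)
  qed (use 0(6) in blast)
  then have "w = u" by blast
  then show ?case by (simp add: h_bruhat_le_def)
next
  case (Suc d)
  note w = Suc.prems(2) and u = Suc.prems(3) and pre = Suc.prems(5) and cnt = Suc.prems(6)
  have kn: "k \<in> {1..n}" using Suc.hyps(2) Suc.prems(4) by simp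
  define b where "b = u k"
  have "b \<in> {1..n}" using permutes_in_range[OF u kn] by (simp add: b_def)
  then obtain q where q: "q \<in> {1..n}" "w q = b"
    using w by (metis permutes_image imageE)
  have "k \<le> q"
  proof (rule ccontr)
    assume "\<not> k \<le> q"
    then have "u q = u k" using pre[of q] q by (simp add: b_def)
    then have "q = k" using permutes_inj[OF u] by (simp add: inj_eq)
    then show False using \<open>\<not> k \<le> q\<close> by simp
  qed
  \<comment> \<open>With equal prefixes before \<open>k\<close>, a larger \<open>w k\<close> would
    give \<open>w\<close> more entries than \<open>u\<close> at threshold \<open>w k\<close> among
    the first \<open>k\<close>.\<close>
  have "w k \<le> b"
  proof (rule ccontr)
    assume "\<not> w k \<le> b"
    then have k_notin: "k \<notin> {m \<in> {1..k}. w k \<le> u m}" by (simp add: b_def)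
    have "{m \<in> {1..k}. w k \<le> u m} \<subseteq> {m \<in> {1..k}. w k \<le> w m}"
    proof
      fix m assume m: "m \<in> {m \<in> {1..k}. w k \<le> u m}"
      with k_notin have "m \<noteq> k" by blast
      with m have "m < k" by simp
      then show "m \<in> {m \<in> {1..k}. w k \<le> w m}" using m pre by simp
    qed
    moreover have "k \<in> {m \<in> {1..k}. w k \<le> w m}" using kn by simp
    ultimately have "{m \<in> {1..k}. w k \<le> u m} \<subset> {m \<in> {1..k}. w k \<le> w m}"
      using k_notin by blast
    then have "prefix_count u k (w k) < prefix_count w k (w k)"
      unfolding prefix_count_def by (intro psubset_card_mono) auto
    then show False using cnt by (simp add: leD)
  qed
  have "q \<le> n" using q by simp
  then have "b \<in> w ` {k..n}" using q \<open>k \<le> q\<close> by auto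
  then have nxt: "\<forall>p p'. record_pos w b k p \<longrightarrow> next_record w b p p' \<longrightarrow> p' \<le> h p"
    using suffix_generator_next_record[OF Suc.prems(7) w] Suc.prems(4) by blast
  obtain x where x: "x permutes {1..n}" "h_bruhat_le n h w x" "x k = b"
    and x_lt: "\<And>m. m < k \<Longrightarrow> x m = w m"
    and x_nrec: "\<And>m. m > k \<Longrightarrow> \<not> record_pos w b k m \<Longrightarrow> x m = w m"
    and x_rec: "\<And>m. m > k \<Longrightarrow> record_pos w b k m \<Longrightarrow>
      \<exists>p. record_pos w b k p \<and> next_record w b p m \<and> x m = w p"
    and x_count: "\<And>p v. prefix_count x p v \<le> prefix_count w p v +
       (if k \<le> p \<and> v \<le> b \<and> (\<forall>m\<in>{k..p}. \<not> (v \<le> w m \<and> w m \<le> b)) then 1 else 0)"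
    using bubble_value[where h = h, OF w kn \<open>k \<le> q\<close> \<open>q \<le> n\<close> q(2) \<open>w k \<le> b\<close> nxt] by blast
  \<comment> \<open>The count can rise only if \<open>w\<close> has no entry from \<open>v\<close>
    to \<open>b\<close> on \<open>{k..p}\<close>. There \<open>u\<close> has one,
    \<open>u k = b\<close>, and it agrees with \<open>w\<close> before \<open>k\<close>; with
    domination above \<open>b\<close> this leaves room for the increase by one.\<close>
  have "prefix_count x p v \<le> prefix_count u p v" for p v
  proof (cases "k \<le> p \<and> v \<le> b \<and> (\<forall>m\<in>{k..p}. \<not> (v \<le> w m \<and> w m \<le> b))")
    case True
    have "{m \<in> {1..p}. v \<le> w m \<and> w m \<le> b} \<subset> {m \<in> {1..p}. v \<le> u m \<and> u m \<le> b}"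
    proof (rule psubsetI)
      show "{m \<in> {1..p}. v \<le> w m \<and> w m \<le> b} \<subseteq> {m \<in> {1..p}. v \<le> u m \<and> u m \<le> b}"
      proof
        fix m assume m: "m \<in> {m \<in> {1..p}. v \<le> w m \<and> w m \<le> b}"
        then have "m \<notin> {k..p}" using True by blast
        then have "m < k" using m by simp
        then show "m \<in> {m \<in> {1..p}. v \<le> u m \<and> u m \<le> b}" using m pre by simp
      qed
      have "k \<in> {m \<in> {1..p}. v \<le> u m \<and> u m \<le> b}"
        using True kn by (simp add: b_def)
      moreover have "k \<notin> {m \<in> {1..p}. v \<le> w m \<and> w m \<le> b}"
        using True by auto
      ultimately show "{m \<in> {1..p}. v \<le> w m \<and> w m \<le> b} \<noteq> {m \<in> {1..p}. v \<le> u m \<and> u m \<le> b}"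
        by blast
    qed
    then have "card {m \<in> {1..p}. v \<le> w m \<and> w m \<le> b} < card {m \<in> {1..p}. v \<le> u m \<and> u m \<le> b}"
      by (intro psubset_card_mono) auto
    then have "prefix_count w p v < prefix_count u p v"
      using True cnt[of p "b + 1"] by (simp add: prefix_count_split[of v b])
    then show ?thesis using x_count[of p v] True by simp
  next
    case False
    then show ?thesis using x_count[of p v] cnt[of p v] by (simp only: if_False add_0_right)
  qed
  moreover have "x m = u m" if "m < Suc k" for m
    using that x_lt[of m] pre[of m] x(3) by (cases "m = k") (auto simp: b_def)
  moreover have "suffix_generator n h (Suc k) x"
  proof (rule suffix_generator_bubble[OF Suc.prems(7) w x(1) Suc.prems(1,4) _ q(2) x(3)])
    show "q \<in> {k..n}" using \<open>k \<le> q\<close> \<open>q \<le> n\<close> by simp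
  qed (fact x_lt x_nrec x_rec)+
  ultimately have "h_bruhat_le n h x u"
    using Suc.hyps(2) Suc.prems(1) x(1) u by (intro Suc.hyps(1)[of "Suc k"]) auto
  then show ?case using x(2) unfolding h_bruhat_le_def by simp
qed

section \<open>The chain from \<open>u\<close> up to the longest permutation\<close>

text \<open>Upper bounds propagate rightwards from position 1, lower bounds leftwards from position
  \<open>n\<close>, and they meet at \<open>n + 1 - i\<close>.\<close>

lemma no_ascent_imp_longest_perm:
  assumes u: "u permutes {1..n}" and desc: "\<And>i. 1 \<le> i \<Longrightarrow> i < n \<Longrightarrow> u (Suc i) < u i"
  shows "u = longest_perm n"
proof
  fix i
  have upper: "i \<le> n \<Longrightarrow> u i \<le> n + 1 - i" if "1 \<le> i" for i
    using that
  proof (induction i rule: dec_induct)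
    case base
    then show ?case using permutes_in_range[OF u, of 1] by simp
  next
    case (step i)
    then show ?case using desc[of i] by simp
  qed
  have lower: "1 \<le> i \<Longrightarrow> n + 1 - i \<le> u i" if "i \<le> n" for i
    using that
  proof (induction i rule: inc_induct)
    case base
    then show ?case using permutes_in_range[OF u, of n] by simp
  next
    case (step i)
    then show ?case using desc[of i] by simp
  qed
  show "u i = longest_perm n i"
    using upper[of i] lower[of i] permutes_not_in[OF u, of i] by (auto simp: longest_perm_def)
qed

text \<open>
  If \<open>h i = i < n\<close>, then the generator condition forces the values of \<open>w\<close>, hence also those of \<open>u\<close>,
  on \<open>1, \<dots>, i\<close> to be the \<open>i\<close> largest ones.
\<close>

lemma ascent_above_generator:
  assumes hess: "hessenberg n h" and gen: "hessenberg_generator n h w"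
    and u: "u permutes {1..n}" and cnt: "\<And>p v. prefix_count w p v \<le> prefix_count u p v"
    and i: "1 \<le> i" "i < n" "u i < u (Suc i)"
  shows "Suc i \<le> h i"
proof (rule ccontr)
  assume "\<not> Suc i \<le> h i"
  then have hi: "h m \<le> i" if "m \<in> {1..i}" for m
  proof -
    have "h m \<le> h i"
      using hess i that unfolding hessenberg_def by (auto elim!: mono_onD)
    then show ?thesis using \<open>\<not> Suc i \<le> h i\<close> by simp
  qed
  have w: "w permutes {1..n}" using gen by (simp add: hessenberg_generator_def)
  define S where "S = w ` {1..i}"
  have S_sub: "S \<subseteq> {1..n}" using i permutes_in_range[OF w] by (fastforce simp: S_def)
  \<comment> \<open>Since \<open>h m \<le> i\<close> for all \<open>m\<close> in
    \<open>{1..i}\<close>, the position of the next larger value never leaves the first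
    \<open>i\<close> positions.\<close>
  have up: "Suc x \<in> S" if "x \<in> S" "x < n" for x
  proof -
    obtain m where m: "m \<in> {1..i}" "x = w m" using \<open>x \<in> S\<close> by (auto simp: S_def)
    then have "inv w (Suc x) \<le> h m"
      using gen i that by (auto simp: hessenberg_generator_def)
    moreover have "inv w (Suc x) \<in> {1..n}"
      using that by (intro permutes_in_range[OF permutes_inv[OF w]]) simp
    ultimately have "inv w (Suc x) \<in> {1..i}" using hi[OF m(1)] by simp
    then show ?thesis using w unfolding S_def by (metis imageI permutes_inverses(1))
  qed
  have fin: "finite S" "S \<noteq> {}" using i by (auto simp: S_def)
  define a where "a = Min S"
  have a: "a \<in> S" "\<And>x. x \<in> S \<Longrightarrow> a \<le> x" using fin by (auto simp: a_def)
  have "x \<in> S" if "a \<le> x" "x \<le> n" for x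
    using that by (induction x rule: dec_induct) (auto simp: a up)
  then have S: "S = {a..n}" using S_sub a by auto
  have card_S: "card S = i"
    using w unfolding S_def by (metis card_atLeastAtMost card_image diff_Suc_1 inj_on_subset
      permutes_inj subset_UNIV)
  have "prefix_count w i a = i"
  proof -
    have "{m \<in> {1..i}. a \<le> w m} = {1..i}" using a by (auto simp: S_def)
    then show ?thesis by (simp add: prefix_count_def)
  qed
  then have "i \<le> prefix_count u i a" using cnt[of i a] by simp
  then have "{m \<in> {1..i}. a \<le> u m} = {1..i}"
    unfolding prefix_count_def by (intro card_seteq) auto
  then have ge: "a \<le> u m" if "m \<in> {1..i}" for m using that by blast
  have "u ` {1..i} \<subseteq> S"
    using ge i permutes_in_range[OF u] by (fastforce simp: S)
  moreover have "card (u ` {1..i}) = i"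
    using u by (metis card_atLeastAtMost card_image diff_Suc_1 inj_on_subset permutes_inj subset_UNIV)
  ultimately have "u ` {1..i} = S" using card_S fin by (intro card_subset_eq) auto
  \<comment> \<open>The ascent puts \<open>u (Suc i)\<close> above \<open>a\<close> too, so it
    repeats a value from the first \<open>i\<close> positions.\<close>
  moreover have "u (Suc i) \<in> S"
    using S ge[of i] i permutes_in_range[OF u, of "Suc i"] by auto
  ultimately obtain m where "m \<in> {1..i}" "u m = u (Suc i)" by auto
  then show False using u by (metis Suc_n_not_le_n atLeastAtMost_iff injD permutes_inj)
qed

text \<open>Exchanging an adjacent ascent is an \<open>h\<close>-step that preserves domination over
  \<open>w\<close> and raises the length, which is at most \<open>n * n\<close>; so this ends at a
  permutation without ascents.\<close>

lemma h_bruhat_le_longest_perm: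
  assumes "hessenberg n h" "hessenberg_generator n h w" "u permutes {1..n}"
    and "\<And>p v. prefix_count w p v \<le> prefix_count u p v"
  shows "h_bruhat_le n h u (longest_perm n)"
  using assms(3,4)
proof (induction "n * n - perm_length n u" arbitrary: u rule: less_induct)
  case less
  show ?case
  proof (cases "\<exists>i. 1 \<le> i \<and> i < n \<and> u i < u (Suc i)")
    case True
    then obtain i where i: "1 \<le> i" "i < n" "u i < u (Suc i)" by auto
    have "Suc i \<le> h i"
      using assms(1,2) less.prems i by (rule ascent_above_generator)
    let ?v = "u \<circ> transpose i (Suc i)"
    have step: "h_bruhat_step n h u ?v"
      using i less.prems(1) \<open>Suc i \<le> h i\<close> by (intro h_bruhat_step_transpose) auto
    have "perm_length n ?v \<le> card ({1..n} \<times> {1..n})"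
      unfolding perm_length_def by (intro card_mono) auto
    then have "perm_length n ?v \<le> n * n" by simp
    moreover have "perm_length n u < perm_length n ?v"
      using i by (intro perm_length_transpose_less) auto
    ultimately have "n * n - perm_length n ?v < n * n - perm_length n u" by linarith
    moreover have "?v permutes {1..n}" using less.prems(1) i by (intro transpose_permutes) auto
    moreover have "prefix_count w p v \<le> prefix_count ?v p v" for p v
      using less.prems(2)[of p v] bruhat_step_prefix_count_mono[OF h_bruhat_step_imp_bruhat_step[OF step]]
      by (rule order_trans)
    ultimately have "h_bruhat_le n h ?v (longest_perm n)" by (rule less.hyps)
    then show ?thesis using step unfolding h_bruhat_le_def by simp
  next
    case False
    have "u (Suc i) < u i" if "1 \<le> i" "i < n" for i
      using False that less.prems(1) by (metis injD linorder_neqE_nat n_not_Suc_n permutes_inj)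
    then have "u = longest_perm n" using less.prems(1) no_ascent_imp_longest_perm by blast
    then show ?thesis by (simp add: h_bruhat_le_def)
  qed
qed

section \<open>Equality of the two intervals\<close>

theorem theorem3p4:
  fixes n :: nat and h w :: "nat \<Rightarrow> nat"
  assumes "hessenberg n h"
    and "hessenberg_generator n h w"
  shows "h_bruhat_interval n h w (longest_perm n) = bruhat_interval n w (longest_perm n)"
proof
  show "h_bruhat_interval n h w (longest_perm n) \<subseteq> bruhat_interval n w (longest_perm n)"
    unfolding h_bruhat_interval_def bruhat_interval_def
    by (auto dest: h_bruhat_le_imp_bruhat_le)
next
  have w: "w permutes {1..n}" using assms(2) by (simp add: hessenberg_generator_def)
  show "bruhat_interval n w (longest_perm n) \<subseteq> h_bruhat_interval n h w (longest_perm n)"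
  proof
    fix u assume "u \<in> bruhat_interval n w (longest_perm n)"
    then have u: "u permutes {1..n}" and "bruhat_le n w u"
      by (auto simp: bruhat_interval_def)
    then have cnt: "prefix_count w p v \<le> prefix_count u p v" for p v
      by (rule_tac bruhat_le_prefix_count_mono)
    \<comment> \<open>Only position 0 precedes 1, and both permutations fix it.\<close>
    have "w m = u m" if "m < 1" for m
      using that w u by (metis atLeastAtMost_iff not_le permutes_not_in)
    then have "h_bruhat_le n h w u"
      using assms w u cnt hessenberg_generator_imp_suffix_generator
      by (intro suffix_generator_h_bruhat_le[of n h w u 1]) auto
    moreover have "h_bruhat_le n h u (longest_perm n)"
      using assms u cnt by (rule h_bruhat_le_longest_perm)
    ultimately show "u \<in> h_bruhat_interval n h w (longest_perm n)"
      using u by (simp add: h_bruhat_interval_def)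
  qed
qed

end
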